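(* Let $S$ be a subordinator with Laplace exponent $\phi$ such that (A-1) and (A-3) hold, and let $u$ be the decreasing density of its potential measure. Then $$u(t)\asymp t^{-2}\frac{\phi'(t^{-1})}{\phi(t^{-1})^2},\quad t\to0+ .$$
   Context: A subordinator $S=(S_t)_{t\ge0}$ is a Lévy process with values in $[0,\infty)$ started at $0$; its Laplace exponent $\phi$ is given by $\mathbb{E}e^{-\lambda S_t}=e^{-t\phi(\lambda)}$, $\lambda>0$. The potential measure of $S$ is $U(A)=\int_0^\infty\mathbb{P}(S_t\in A)\,dt$. "Decreasing" means: $s\le t$ implies $f(s)\ge f(t)$. $f(t)\asymp g(t)$, $t\to0+$, means that $f(t)/g(t)$ stays between two positive constants as $t\to0+$. (A-1) $U$ has a decreasing density, i.e. there is a decreasing function $u\colon(0,\infty)\to(0,\infty)$ with $U(dt)=u(t)\,dt$. (A-3) There exist constants $\sigma>0$, $\lambda_0>0$, $\delta>0$ such that $\frac{\phi'(\lambda x)}{\phi'(\lambda)}\le\sigma x^{-\delta}$ for all $x\ge1$ and $\lambda\ge\lambda_0$. *)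

theory Defs
  imports "HOL-Probability.Probability"
begin

text \<open>
  Processes are indexed by all reals, but only the times \<open>t \<ge> 0\<close> matter. Real-valued Levy processes
  here start at 0, almost surely. Stochastic continuity is implied by the other conditions, and is
  listed because it is usually part of the definition.
\<close>

locale levy_process = prob_space M for M :: "'a measure" +
  fixes S :: "real \<Rightarrow> 'a \<Rightarrow> real"
  assumes random_variable: "\<And>t. t \<ge> 0 \<Longrightarrow> random_variable borel (S t)"
    and start: "AE \<omega> in M. S 0 \<omega> = 0"
    and indep_increments:
      "\<And>n (t :: nat \<Rightarrow> real). t 0 \<ge> 0 \<Longrightarrow> mono_on {..n} t \<Longrightarrow>
         indep_vars (\<lambda>_. borel) (\<lambda>i \<omega>. S (t (Suc i)) \<omega> - S (t i) \<omega>) {..<n}"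
    and stationary_increments:
      "\<And>s h. s \<ge> 0 \<Longrightarrow> h \<ge> 0 \<Longrightarrow>
         distr M borel (\<lambda>\<omega>. S (s + h) \<omega> - S s \<omega>) = distr M borel (\<lambda>\<omega>. S h \<omega> - S 0 \<omega>)"
    and stochastically_continuous:
      "\<And>t \<epsilon>. t \<ge> 0 \<Longrightarrow> \<epsilon> > 0 \<Longrightarrow>
         ((\<lambda>s. prob {\<omega> \<in> space M. \<bar>S s \<omega> - S t \<omega>\<bar> > \<epsilon>}) \<longlongrightarrow> 0) (at t within {0..})"
    and cadlag:
      "AE \<omega> in M. \<forall>t\<ge>0. continuous (at_right t) (\<lambda>s. S s \<omega>) \<and>
         (t > 0 \<longrightarrow> (\<exists>l. ((\<lambda>s. S s \<omega>) \<longlongrightarrow> l) (at_left t)))"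

locale subordinator = levy_process +
  assumes nonneg: "\<And>t \<omega>. t \<ge> 0 \<Longrightarrow> \<omega> \<in> space M \<Longrightarrow> S t \<omega> \<ge> 0"

definition laplace_exponent :: "'a measure \<Rightarrow> (real \<Rightarrow> 'a \<Rightarrow> real) \<Rightarrow> (real \<Rightarrow> real) \<Rightarrow> bool" where
  "laplace_exponent M S \<phi> \<longleftrightarrow>
     (\<forall>t\<ge>0. \<forall>\<mu>>0. (LINT \<omega>|M. exp (- \<mu> * S t \<omega>)) = exp (- t * \<phi> \<mu>))"

definition potential_measure ::
    "'a measure \<Rightarrow> (real \<Rightarrow> 'a \<Rightarrow> real) \<Rightarrow> real set \<Rightarrow> ennreal" where
  "potential_measure M S A =
     (\<integral>\<^sup>+t\<in>{0..}. emeasure M {\<omega> \<in> space M. S t \<omega> \<in> A} \<partial>lborel)"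

text \<open>
  The set \<open>A\<close> may contain 0, so an atom of the potential measure at 0 is excluded.
\<close>

definition decreasing_potential_density ::
    "'a measure \<Rightarrow> (real \<Rightarrow> 'a \<Rightarrow> real) \<Rightarrow> (real \<Rightarrow> real) \<Rightarrow> bool" where
  "decreasing_potential_density M S u \<longleftrightarrow>
     (\<forall>t>0. u t > 0) \<and> antimono_on {0<..} u \<and>
     (\<forall>A \<in> sets borel. potential_measure M S A = (\<integral>\<^sup>+t\<in>A \<inter> {0<..}. ennreal (u t) \<partial>lborel))"

definition deriv_scaling_condition :: "(real \<Rightarrow> real) \<Rightarrow> bool" where
  "deriv_scaling_condition \<phi> \<longleftrightarrow>
     (\<exists>\<sigma>>0. \<exists>\<mu>\<^sub>0>0. \<exists>\<delta>>0. \<forall>x\<ge>1. \<forall>\<mu>\<ge>\<mu>\<^sub>0.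
        deriv \<phi> (\<mu> * x) / deriv \<phi> \<mu> \<le> \<sigma> * x powr (- \<delta>))"

text \<open>
  As \<open>x / 0 = 0\<close>, the lower bound forces \<open>g t \<noteq> 0\<close> near 0.
\<close>

definition comparable_at_zero :: "(real \<Rightarrow> real) \<Rightarrow> (real \<Rightarrow> real) \<Rightarrow> bool" where
  "comparable_at_zero f g \<longleftrightarrow>
     (\<exists>c\<^sub>1>0. \<exists>c\<^sub>2>0. \<forall>\<^sub>F t in at_right 0. c\<^sub>1 \<le> f t / g t \<and> f t / g t \<le> c\<^sub>2)"

end

theory Submission
  imports Defs
begin

text \<open>
  Let \<open>L(l) = \<integral> exp (- l x) u(x) dx\<close> be the Laplace transform of the potential measure. Integrating
  \<open>E exp (- l S\<^sub>t) = exp (- t \<phi>(l))\<close> over \<open>t \<ge> 0\<close> gives \<open>L = 1 / \<phi>\<close>, and differentiating gives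
  \<open>\<phi>' / \<phi>\<^sup>2 = G\<close>, where \<open>G(l) = \<integral> x exp (- l x) u(x) dx\<close>. The claim is therefore that \<open>u(t)\<close> and
  \<open>t\<^sup>-\<^sup>2 G(1/t)\<close> are comparable, a statement about the decreasing function \<open>u\<close> alone.

  One direction needs only that \<open>u\<close> decreases: on \<open>[t/2, t]\<close> the integrand of \<open>G(1/t)\<close> is at least
  a constant multiple of \<open>t u(t)\<close> (lemma \<open>density_le_moment\<close>).

  For the other direction, the factor \<open>\<phi>\<^sup>2\<close> increases, so the scaling condition on \<open>\<phi>'\<close> passes to
  \<open>G\<close>: \<open>G(l x) \<le> \<sigma> x\<^sup>-\<^sup>\<delta> G(l)\<close>. Take \<open>l = 1 / (x t)\<close> and split \<open>G(l)\<close> at \<open>t\<close>. The part beyond \<open>t\<close>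
  is at most \<open>u(t) / l\<^sup>2\<close>, and the part below \<open>t\<close> is at most \<open>e G(1/t) = e G(l x)\<close>
  (lemma \<open>moment_split\<close>). Once \<open>x\<close> is so large that \<open>e \<sigma> x\<^sup>-\<^sup>\<delta> \<le> 1/2\<close>, the lower part is absorbed on
  the left, and \<open>G(1/t) \<le> G(l) \<le> 2 u(t) x\<^sup>2 t\<^sup>2\<close>.

  The potential measure is an integral over time, so integrating a function against it requires
  \<open>t \<mapsto> P(S\<^sub>t \<in> A)\<close> to be measurable. This holds because the paths increase: \<open>P(S\<^sub>t \<le> a)\<close> is then
  monotone in \<open>t\<close>, and the half-lines generate the Borel sets.
\<close>

section \<open>Differentiating Laplace transforms\<close>

lemma abs_exp_minus_diff_le:
  fixes a b c :: real
  assumes "c \<le> a" "c \<le> b"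
  shows "\<bar>exp (- a) - exp (- b)\<bar> \<le> \<bar>a - b\<bar> * exp (- c)"
proof -
  have *: "exp (- a) - exp (- b) \<le> (b - a) * exp (- c)" if "a \<le> b" "c \<le> a" for a b :: real
  proof -
    have "exp (- a) - exp (- b) = exp (- a) * (1 - exp (- (b - a)))"
      by (simp add: algebra_simps flip: exp_add)
    also have "\<dots> \<le> exp (- c) * (b - a)"
    proof (rule mult_mono)
      show "1 - exp (- (b - a)) \<le> b - a"
        using exp_ge_add_one_self[of "- (b - a)"] by linarith
    qed (use that in auto)
    finally show ?thesis by (simp add: mult.commute)
  qed
  show ?thesis
    using *[of a b] *[of b a] assms by (cases "a \<le> b") (auto simp: abs_if)
qed

lemma mult_exp_minus_le:
  fixes c x :: real
  assumes "c > 0"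
  shows "x * exp (- (2 * c) * x) \<le> (1 / c) * exp (- c * x)"
proof -
  have "c * x \<le> exp (c * x)"
    using exp_ge_add_one_self[of "c * x"] by linarith
  then have "c * x * exp (- (2 * c) * x) \<le> exp (c * x) * exp (- (2 * c) * x)"
    by (intro mult_right_mono) auto
  also have "\<dots> = exp (- c * x)"
    by (simp flip: exp_add)
  finally show ?thesis
    using assms by (simp add: field_simps)
qed

text \<open>
  Dominated convergence for the difference quotients: once \<open>m \<ge> l / 2\<close>, the quotient between \<open>l\<close>
  and \<open>m\<close> is at most \<open>X exp (- (l / 2) X)\<close>, and half of the remaining exponential absorbs the
  factor \<open>X\<close>. The majorant is thus again a transform integrand, at \<open>l / 4\<close>.
\<close>

lemma
  fixes X :: "'b \<Rightarrow> real"
  assumes X [measurable]: "X \<in> borel_measurable N"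
    and nonneg: "AE x in N. 0 \<le> X x"
    and int: "\<And>l. l > 0 \<Longrightarrow> integrable N (\<lambda>x. exp (- l * X x))"
    and l: "l > 0"
  shows laplace_moment_integrable: "integrable N (\<lambda>x. X x * exp (- l * X x))"
    and laplace_has_derivative:
      "((\<lambda>l. LINT x|N. exp (- l * X x)) has_real_derivative
         - (LINT x|N. X x * exp (- l * X x))) (at l)"
proof -
  have dom: "integrable N (\<lambda>x. (4 / l) * exp (- (l / 4) * X x))"
    using int[of "l / 4"] l by simp
  have le: "X x * exp (- (l / 2) * X x) \<le> (4 / l) * exp (- (l / 4) * X x)" for x
    using mult_exp_minus_le[of "l / 4" "X x"] l by simp
  show moment: "integrable N (\<lambda>x. X x * exp (- l * X x))"
  proof (rule Bochner_Integration.integrable_bound[OF dom])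
    show "AE x in N. norm (X x * exp (- l * X x)) \<le> norm ((4 / l) * exp (- (l / 4) * X x))"
      using nonneg
    proof eventually_elim
      case (elim x)
      have "X x * exp (- l * X x) \<le> X x * exp (- (l / 2) * X x)"
        using elim l by (intro mult_left_mono) (auto intro: mult_right_mono)
      with le[of x] elim l show ?case by simp
    qed
  qed measurable
  let ?L = "\<lambda>l. LINT x|N. exp (- l * X x)"
  let ?D = "\<lambda>m x. (exp (- m * X x) - exp (- l * X x)) / (m - l)"
  have "((\<lambda>m. (?L m - ?L l) / (m - l)) \<longlongrightarrow> - (LINT x|N. X x * exp (- l * X x)))
      (at l within {l / 2<..})"
    unfolding tendsto_at_iff_sequentially
  proof (intro allI impI)
    fix m :: "nat \<Rightarrow> real"
    assume m: "\<forall>i. m i \<in> {l / 2<..} - {l}" and lim: "m \<longlonglongrightarrow> l"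
    have pos: "m i > 0" for i
      using m l by (auto intro: less_trans[of 0 "l / 2"])
    have quotient: "(?L (m i) - ?L l) / (m i - l) = (LINT x|N. ?D (m i) x)" for i
      using int[OF pos[of i]] int[OF l] by simp
    have "(\<lambda>i. LINT x|N. ?D (m i) x) \<longlonglongrightarrow> (LINT x|N. - (X x * exp (- l * X x)))"
    proof (rule integral_dominated_convergence)
      show "integrable N (\<lambda>x. (4 / l) * exp (- (l / 4) * X x))" by (rule dom)
      show "AE x in N. (\<lambda>i. ?D (m i) x) \<longlonglongrightarrow> - (X x * exp (- l * X x))"
      proof (rule AE_I2)
        fix x
        have "((\<lambda>l. exp (- l * X x)) has_real_derivative - (X x * exp (- l * X x))) (at l)"
          by (auto intro!: derivative_eq_intros)
        then have "((\<lambda>m. ?D m x) \<longlongrightarrow> - (X x * exp (- l * X x))) (at l)"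
          by (simp add: has_field_derivative_iff)
        then show "(\<lambda>i. ?D (m i) x) \<longlonglongrightarrow> - (X x * exp (- l * X x))"
          using m lim by (auto simp: tendsto_at_iff_sequentially comp_def)
      qed
      show "AE x in N. norm (?D (m i) x) \<le> (4 / l) * exp (- (l / 4) * X x)" for i
        using nonneg
      proof eventually_elim
        case (elim x)
        have mi: "m i \<ge> l / 2" "m i \<noteq> l" using m by (auto intro: less_imp_le)
        have "\<bar>exp (- (m i * X x)) - exp (- (l * X x))\<bar>
            \<le> \<bar>m i * X x - l * X x\<bar> * exp (- ((l / 2) * X x))"
          using mi l elim by (intro abs_exp_minus_diff_le mult_right_mono) auto
        also have "\<bar>m i * X x - l * X x\<bar> = \<bar>m i - l\<bar> * X x"
          using elim by (simp add: abs_mult flip: left_diff_distrib)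
        finally have "norm (?D (m i) x) \<le> X x * exp (- (l / 2) * X x)"
          using mi by (simp add: field_simps abs_if split: if_splits)
        with le[of x] show ?case by linarith
      qed
    qed measurable
    then show "((\<lambda>m. (?L m - ?L l) / (m - l)) \<circ> m)
        \<longlonglongrightarrow> - (LINT x|N. X x * exp (- l * X x))"
      unfolding comp_def quotient by simp
  qed
  moreover have "at l within {l / 2<..} = at l"
    using l by (intro at_within_open) auto
  ultimately show "(?L has_real_derivative - (LINT x|N. X x * exp (- l * X x))) (at l)"
    by (simp add: has_field_derivative_iff)
qed

section \<open>Decreasing densities and their Laplace transforms\<close>

text \<open>
  The density is extended by zero to the whole line, so that all integrals are over \<open>lborel\<close>.
\<close>

locale decreasing_density =
  fixes v :: "real \<Rightarrow> real"
  assumes measurable_density [measurable]: "v \<in> borel_measurable borel"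
    and pos: "\<And>x. x > 0 \<Longrightarrow> v x > 0"
    and zero: "\<And>x. x \<le> 0 \<Longrightarrow> v x = 0"
    and antimono: "antimono_on {0<..} v"
    and laplace_integrable: "\<And>l. l > 0 \<Longrightarrow> integrable lborel (\<lambda>x. v x * exp (- l * x))"
begin

lemma density_nonneg: "v x \<ge> 0"
  using pos[of x] zero[of x] by (cases "x > 0") auto

definition laplace :: "real \<Rightarrow> real" where
  "laplace l = (LINT x|lborel. v x * exp (- l * x))"

definition moment :: "real \<Rightarrow> real" where
  "moment l = (LINT x|lborel. v x * (x * exp (- l * x)))"

lemma
  assumes l: "l > 0"
  shows moment_integrable: "integrable lborel (\<lambda>x. v x * (x * exp (- l * x)))"
    and has_derivative_laplace: "(laplace has_real_derivative - moment l) (at l)"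
proof -
  let ?N = "density lborel (\<lambda>x. ennreal (v x))"
  have conv: "integrable ?N f \<longleftrightarrow> integrable lborel (\<lambda>x. v x * f x)"
    and conv': "(LINT x|?N. f x) = (LINT x|lborel. v x * f x)"
    if [measurable]: "f \<in> borel_measurable borel" for f :: "real \<Rightarrow> real"
    using density_nonneg by (auto simp: integrable_real_density integral_real_density)
  have "AE x in lborel. 0 < ennreal (v x) \<longrightarrow> 0 \<le> x"
  proof (rule AE_I2)
    show "0 < ennreal (v x) \<longrightarrow> 0 \<le> x" for x
      using zero[of x] by (cases "x \<le> 0") auto
  qed
  then have AE: "AE x in ?N. 0 \<le> x"
    by (subst AE_density) auto
  have int: "integrable ?N (\<lambda>x. exp (- l * x))" if "l > 0" for l
    using laplace_integrable[OF that] by (subst conv) auto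
  have eq: "laplace = (\<lambda>l. LINT x|?N. exp (- l * x))"
    by (rule ext, subst conv') (auto simp: laplace_def)
  have "integrable ?N (\<lambda>x. x * exp (- l * x))"
    using AE int l by (intro laplace_moment_integrable) auto
  then show "integrable lborel (\<lambda>x. v x * (x * exp (- l * x)))"
    by (subst (asm) conv) auto
  have "(laplace has_real_derivative - (LINT x|?N. x * exp (- l * x))) (at l)"
    unfolding eq using AE int l by (intro laplace_has_derivative) auto
  then show "(laplace has_real_derivative - moment l) (at l)"
    by (subst (asm) conv') (auto simp: moment_def)
qed

lemma laplace_antimono:
  assumes "0 < l" "l \<le> m"
  shows "laplace m \<le> laplace l"
  unfolding laplace_def
proof (rule integral_mono)
  show "v x * exp (- m * x) \<le> v x * exp (- l * x)" for x
    using assms zero[of x] density_nonneg[of x]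
    by (cases "x \<le> 0") (auto intro!: mult_left_mono mult_right_mono)
qed (use assms laplace_integrable in auto)

lemma moment_antimono:
  assumes "0 < l" "l \<le> m"
  shows "moment m \<le> moment l"
  unfolding moment_def
proof (rule integral_mono)
  show "v x * (x * exp (- m * x)) \<le> v x * (x * exp (- l * x))" for x
    using assms zero[of x] density_nonneg[of x]
    by (cases "x \<le> 0") (auto intro!: mult_left_mono mult_right_mono)
qed (use assms moment_integrable in auto)

text \<open>
  On \<open>[t/2, t]\<close> the integrand of \<open>moment (1 / t)\<close> is at least \<open>v t * (t/2) * exp (- 1)\<close>, and the
  interval has length \<open>t/2\<close>.
\<close>

lemma density_le_moment:
  assumes t: "t > 0"
  shows "v t \<le> 4 * exp 1 * (moment (1 / t) / t\<^sup>2)"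
proof -
  have "(LINT x|lborel. indicator {t / 2..t} x * (v t * (t / 2 * exp (- 1)))) \<le> moment (1 / t)"
    unfolding moment_def
  proof (rule integral_mono)
    show "integrable lborel (\<lambda>x. v x * (x * exp (- (1 / t) * x)))"
      using t by (intro moment_integrable) auto
    show "integrable lborel (\<lambda>x. indicator {t / 2..t} x * (v t * (t / 2 * exp (- 1))))"
      by (intro integrable_mult_left) (auto simp: emeasure_lborel_Icc_eq)
    fix x :: real
    show "indicator {t / 2..t} x * (v t * (t / 2 * exp (- 1))) \<le> v x * (x * exp (- (1 / t) * x))"
    proof (cases "x \<in> {t / 2..t}")
      case True
      have "v t * (t / 2 * exp (- 1)) \<le> v x * (x * exp (- (1 / t) * x))"
      proof (intro mult_mono)
        show "v t \<le> v x"
          using True t by (intro monotone_onD[OF antimono]) auto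
      qed (use True t density_nonneg in \<open>auto simp: field_simps\<close>)
      with True show ?thesis by simp
    next
      case False
      then show ?thesis
        using zero[of x] density_nonneg[of x] by (cases "x \<le> 0") auto
    qed
  qed
  then show ?thesis
    using t by (simp add: field_simps power2_eq_square exp_minus)
qed

lemma moment_pos:
  assumes "l > 0"
  shows "moment l > 0"
proof -
  have "0 < v (1 / l)"
    using assms by (intro pos) auto
  also have "\<dots> \<le> 4 * exp 1 * (moment l / (1 / l)\<^sup>2)"
    using density_le_moment[of "1 / l"] assms by simp
  finally show ?thesis
    using assms by (simp add: zero_less_mult_iff power2_eq_square)
qed

lemma laplace_pos:
  assumes l: "l > 0"
  shows "laplace l > 0"
proof -
  have "moment (2 * l) \<le> (1 / l) * laplace l"
    unfolding moment_def laplace_def integral_mult_right_zero[symmetric]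
  proof (rule integral_mono)
    show "v x * (x * exp (- (2 * l) * x)) \<le> 1 / l * (v x * exp (- l * x))" for x
      using mult_left_mono[OF mult_exp_minus_le[OF l, of x] density_nonneg[of x]]
      by (simp add: algebra_simps)
  qed (use l laplace_integrable moment_integrable[of "2 * l"] in auto)
  moreover have "0 < moment (2 * l)"
    using l by (intro moment_pos) auto
  ultimately show ?thesis
    using l order_less_le_trans[of 0 "moment (2 * l)" "(1 / l) * laplace l"]
    by (simp add: zero_less_divide_iff)
qed

text \<open>
  Splitting the integral at \<open>r\<close>: below \<open>r\<close> the weight \<open>exp (- l x)\<close> is at most \<open>e exp (- x / r)\<close>,
  and beyond \<open>r\<close> the density is at most \<open>v r\<close>.
\<close>

lemma moment_split:
  assumes l: "l > 0" and r: "r > 0"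
  shows "moment l \<le> exp 1 * moment (1 / r) + v r / l\<^sup>2"
proof -
  \<comment> \<open>The Erlang density is a probability density, which gives the value \<open>1 / l\<^sup>2\<close> for the
    integral of \<open>x exp (- l x)\<close> over the half-line.\<close>
  let ?w = "\<lambda>x. erlang_density 1 l x / l\<^sup>2"
  have "has_bochner_integral lborel (erlang_density 1 l) 1"
    using nn_integral_erlang_ith_moment[OF l, of 1 0] l
    by (intro has_bochner_integral_nn_integral) auto
  then have w: "integrable lborel ?w" "(LINT x|lborel. ?w x) = 1 / l\<^sup>2"
    by (auto simp: has_bochner_integral_iff)
  have int: "integrable lborel (\<lambda>x. v x * (x * exp (- (1 / r) * x)))"
    using r by (intro moment_integrable) auto
  note int' = integrable_mult_right[of "exp 1", OF int] integrable_mult_right[of "v r", OF w(1)]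
  have "moment l \<le> (LINT x|lborel. exp 1 * (v x * (x * exp (- (1 / r) * x))) + v r * ?w x)"
    unfolding moment_def
  proof (rule integral_mono)
    show "integrable lborel (\<lambda>x. exp 1 * (v x * (x * exp (- (1 / r) * x))) + v r * ?w x)"
      by (intro Bochner_Integration.integrable_add int')
    fix x :: real
    let ?a = "exp 1 * (v x * (x * exp (- (1 / r) * x)))"
    have w_eq: "?w x = x * exp (- l * x)" if "x \<ge> 0"
      using that l by (simp add: erlang_density_def power2_eq_square)
    have nonneg: "?w x \<ge> 0"
      using l by (auto intro!: divide_nonneg_nonneg)
    consider "x \<le> 0" | "0 < x" "x \<le> r" | "r < x" by linarith
    then show "v x * (x * exp (- l * x)) \<le> ?a + v r * ?w x"
    proof cases
      case 1
      with zero[of x] mult_nonneg_nonneg[OF density_nonneg[of r] nonneg] show ?thesis by simp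
    next
      case 2
      have "exp (- l * x) \<le> exp (1 + - (1 / r) * x)"
        unfolding exp_le_cancel_iff
      proof -
        have "- l * x \<le> 0" "x / r \<le> 1" using 2 l r by auto
        then show "- l * x \<le> 1 + - (1 / r) * x" by simp
      qed
      then have "v x * (x * exp (- l * x)) \<le> v x * (x * exp (1 + - (1 / r) * x))"
        using 2 density_nonneg[of x] by (intro mult_left_mono) auto
      also have "\<dots> = ?a" by (simp only: exp_add ac_simps)
      finally show ?thesis
        using mult_nonneg_nonneg[OF density_nonneg[of r] nonneg] by linarith
    next
      case 3
      have "v x * (x * exp (- l * x)) \<le> v r * (x * exp (- l * x))"
        using 3 r by (intro mult_right_mono monotone_onD[OF antimono]) auto
      also have "\<dots> = v r * ?w x" using w_eq 3 r by simp
      finally show ?thesis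
        using 3 r density_nonneg[of x] by (simp add: add_increasing)
    qed
  qed (use l moment_integrable in auto)
  also have "\<dots> = exp 1 * moment (1 / r) + v r / l\<^sup>2"
    unfolding Bochner_Integration.integral_add[OF int'] integral_mult_right_zero w(2)
    by (simp add: moment_def)
  finally show ?thesis .
qed

text \<open>
  If the part of the integral below \<open>t\<close> is at most half of the whole, then the part beyond \<open>t\<close>,
  which the single value \<open>v t\<close> controls, makes up the other half.
\<close>

lemma moment_le_density:
  assumes x: "x > 0" and t: "t > 0"
    and small: "exp 1 * moment (1 / t) \<le> moment (1 / (x * t)) / 2"
  shows "moment (1 / (x * t)) \<le> 2 * x\<^sup>2 * t\<^sup>2 * v t"
proof -
  have "moment (1 / (x * t)) \<le> exp 1 * moment (1 / t) + v t / (1 / (x * t))\<^sup>2"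
    using x t by (intro moment_split) auto
  also have "v t / (1 / (x * t))\<^sup>2 = x\<^sup>2 * t\<^sup>2 * v t"
    by (simp add: power_mult_distrib power_divide)
  finally show ?thesis
    using small by linarith
qed

theorem comparable_density_moment:
  assumes \<sigma>: "\<sigma> > 0" and l0: "l\<^sub>0 > 0" and \<delta>: "\<delta> > 0"
    and scaling: "\<And>x l. x \<ge> 1 \<Longrightarrow> l \<ge> l\<^sub>0 \<Longrightarrow> moment (l * x) \<le> \<sigma> * x powr (- \<delta>) * moment l"
  shows "comparable_at_zero v (\<lambda>t. moment (1 / t) / t\<^sup>2)"
proof -
  \<comment> \<open>This is where \<open>e \<sigma> x\<^sup>-\<^sup>\<delta>\<close> drops to 1/2; the maximum keeps \<open>x\<close> in the range of the scaling
    condition.\<close>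
  define x where "x = max 1 ((2 * exp 1 * \<sigma>) powr (1 / \<delta>))"
  have x: "x \<ge> 1" by (simp add: x_def)
  have "2 * exp 1 * \<sigma> = ((2 * exp 1 * \<sigma>) powr (1 / \<delta>)) powr \<delta>"
    using \<sigma> \<delta> by (simp add: powr_powr)
  also have "\<dots> \<le> x powr \<delta>"
    using \<delta> by (intro powr_mono2) (auto simp: x_def)
  finally have x_large: "exp 1 * (\<sigma> * x powr (- \<delta>)) \<le> 1 / 2"
    using x by (simp add: powr_minus field_simps)
  have "\<forall>\<^sub>F t in at_right 0. 0 < t \<and> t \<le> 1 / (x * l\<^sub>0)"
    unfolding eventually_at_right_field
    using x l0 by (intro exI[of _ "1 / (x * l\<^sub>0)"]) auto
  then have "\<forall>\<^sub>F t in at_right 0. 1 / (2 * x\<^sup>2) \<le> v t / (moment (1 / t) / t\<^sup>2)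
      \<and> v t / (moment (1 / t) / t\<^sup>2) \<le> 4 * exp 1"
  proof eventually_elim
    case (elim t)
    then have t: "t > 0" and l: "1 / (x * t) \<ge> l\<^sub>0"
      using x l0 by (auto simp: field_simps)
    have G: "moment (1 / t) > 0"
      using t by (intro moment_pos) auto
    have "exp 1 * moment (1 / t) \<le> exp 1 * (\<sigma> * x powr (- \<delta>)) * moment (1 / (x * t))"
      using scaling[OF x l] x t by simp
    also have "\<dots> \<le> 1 / 2 * moment (1 / (x * t))"
      using x t by (intro mult_right_mono[OF x_large] less_imp_le[OF moment_pos]) auto
    finally have "moment (1 / (x * t)) \<le> 2 * x\<^sup>2 * t\<^sup>2 * v t"
      using x t by (intro moment_le_density) auto
    moreover have "moment (1 / t) \<le> moment (1 / (x * t))"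
      using x t by (intro moment_antimono) (auto simp: field_simps)
    ultimately have "1 / (2 * x\<^sup>2) \<le> v t / (moment (1 / t) / t\<^sup>2)"
      using x t G by (simp add: field_simps)
    moreover have "v t / (moment (1 / t) / t\<^sup>2) \<le> 4 * exp 1"
      using density_le_moment[OF t] t G by (subst pos_divide_le_eq) auto
    ultimately show ?case ..
  qed
  then show ?thesis
    unfolding comparable_at_zero_def
    using x by (intro exI[of _ "1 / (2 * x\<^sup>2)"] conjI exI[of _ "4 * exp 1"]) auto
qed

lemma deriv_reciprocal_laplace:
  assumes \<phi>: "\<And>l. l > 0 \<Longrightarrow> laplace l = 1 / \<phi> l" and l: "l > 0"
  shows "deriv \<phi> l = moment l * (\<phi> l)\<^sup>2"
proof -
  have L: "laplace l \<noteq> 0" using laplace_pos[OF l] by simp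
  have "((\<lambda>l. inverse (laplace l)) has_real_derivative
      - (inverse (laplace l) * - moment l * inverse (laplace l))) (at l)"
    by (intro DERIV_inverse' has_derivative_laplace l L)
  then have "(\<phi> has_real_derivative
      - (inverse (laplace l) * - moment l * inverse (laplace l))) (at l)"
    by (rule DERIV_cong_ev[THEN iffD1, rotated -1])
       (use l in \<open>auto simp: \<phi> inverse_eq_divide intro!: eventually_nhds_in_open[of "{0<..}", THEN eventually_mono]\<close>)
  then have "deriv \<phi> l = - (inverse (laplace l) * - moment l * inverse (laplace l))"
    by (rule DERIV_imp_deriv)
  also have "\<dots> = moment l * (\<phi> l)\<^sup>2"
    using l by (simp add: \<phi> power2_eq_square inverse_eq_divide)
  finally show ?thesis .
qed

end

section \<open>Integrals against the potential measure\<close>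

text \<open>
  Here the mixture \<open>U\<close> of the kernel may be infinite, so that it is not a monadic bind of
  subprobability measures.
\<close>

lemma nn_integral_mixture:
  assumes K [measurable]: "K \<in> measurable L (subprob_algebra N)"
    and sets: "sets U = sets N"
    and U: "\<And>A. A \<in> sets N \<Longrightarrow> emeasure U A = (\<integral>\<^sup>+t. emeasure (K t) A \<partial>L)"
    and f: "f \<in> borel_measurable N"
  shows "(\<integral>\<^sup>+x. f x \<partial>U) = (\<integral>\<^sup>+t. (\<integral>\<^sup>+x. f x \<partial>K t) \<partial>L)"
  using f
proof (induction f rule: borel_measurable_induct)
  case (cong f g)
  have "(\<integral>\<^sup>+x. f x \<partial>U) = (\<integral>\<^sup>+x. g x \<partial>U)"
    using cong.hyps sets_eq_imp_space_eq[OF sets] by (intro nn_integral_cong) auto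
  moreover have "(\<integral>\<^sup>+x. f x \<partial>K t) = (\<integral>\<^sup>+x. g x \<partial>K t)" if "t \<in> space L" for t
    using cong.hyps subprob_measurableD(1)[OF K that] by (intro nn_integral_cong) auto
  ultimately show ?case
    using cong by (simp cong: nn_integral_cong)
next
  case (set A)
  have "(\<integral>\<^sup>+x. indicator A x \<partial>K t) = emeasure (K t) A" if "t \<in> space L" for t
    using set subprob_measurableD(2)[OF K that] by (intro nn_integral_indicator) auto
  then show ?case
    using set sets U by (simp cong: nn_integral_cong)
next
  case (mult f c)
  have [measurable]: "f \<in> borel_measurable N" by fact
  have [measurable]: "f \<in> borel_measurable U"
    using mult sets by (simp cong: measurable_cong_sets)
  have "(\<integral>\<^sup>+x. c * f x \<partial>K t) = c * (\<integral>\<^sup>+x. f x \<partial>K t)" if "t \<in> space L" for t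
    using mult subprob_measurableD(2)[OF K that]
    by (intro nn_integral_cmult) (simp cong: measurable_cong_sets)
  then show ?case
    using mult by (simp add: nn_integral_cmult cong: nn_integral_cong)
next
  case (add f g)
  have [measurable]: "f \<in> borel_measurable N" "g \<in> borel_measurable N" by fact+
  have [measurable]: "f \<in> borel_measurable U" "g \<in> borel_measurable U"
    using add sets by (simp_all cong: measurable_cong_sets)
  have "(\<integral>\<^sup>+x. g x + f x \<partial>K t) = (\<integral>\<^sup>+x. g x \<partial>K t) + (\<integral>\<^sup>+x. f x \<partial>K t)"
    if "t \<in> space L" for t
    using add subprob_measurableD(2)[OF K that]
    by (intro nn_integral_add) (simp_all cong: measurable_cong_sets)
  then show ?case
    using add by (simp add: nn_integral_add cong: nn_integral_cong)
next
  case (seq F)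
  have [measurable]: "F i \<in> borel_measurable N" for i by fact
  have [measurable]: "F i \<in> borel_measurable U" for i
    using seq sets by (simp cong: measurable_cong_sets)
  have mono: "incseq (\<lambda>i. \<integral>\<^sup>+x. F i x \<partial>M)" for M
    using \<open>incseq F\<close> by (auto simp: incseq_def le_fun_def intro!: nn_integral_mono)
  have "(\<integral>\<^sup>+x. (SUP i. F i) x \<partial>K t) = (SUP i. \<integral>\<^sup>+x. F i x \<partial>K t)" if "t \<in> space L" for t
    unfolding SUP_apply using seq subprob_measurableD(2)[OF K that]
    by (intro nn_integral_monotone_convergence_SUP) (simp_all cong: measurable_cong_sets)
  then have "(\<integral>\<^sup>+t. (\<integral>\<^sup>+x. (SUP i. F i) x \<partial>K t) \<partial>L)
      = (\<integral>\<^sup>+t. (SUP i. \<integral>\<^sup>+x. F i x \<partial>K t) \<partial>L)"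
    by (simp cong: nn_integral_cong)
  also have "\<dots> = (SUP i. \<integral>\<^sup>+t. (\<integral>\<^sup>+x. F i x \<partial>K t) \<partial>L)"
  proof (rule nn_integral_monotone_convergence_SUP)
    show "incseq (\<lambda>i t. \<integral>\<^sup>+x. F i x \<partial>K t)"
      using mono by (auto simp: incseq_def le_fun_def)
  qed measurable
  also have "\<dots> = (SUP i. \<integral>\<^sup>+x. F i x \<partial>U)"
    using seq by simp
  also have "\<dots> = (\<integral>\<^sup>+x. (SUP i. F i) x \<partial>U)"
    unfolding SUP_apply using seq
    by (intro nn_integral_monotone_convergence_SUP[symmetric]) auto
  finally show ?case by simp
qed

context subordinator
begin

text \<open>
  Stationarity gives the increment \<open>S (s + h) - S s\<close> the law of \<open>S h - S 0\<close>, which is almost surely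
  nonnegative.
\<close>

lemma AE_increasing:
  assumes s: "0 \<le> s" and st: "s \<le> t"
  shows "AE \<omega> in M. S s \<omega> \<le> S t \<omega>"
proof -
  define h where "h = t - s"
  have h: "h \<ge> 0" "t = s + h" using st by (auto simp: h_def)
  have [measurable]: "S s \<in> borel_measurable M" "S t \<in> borel_measurable M"
    "S h \<in> borel_measurable M" "S 0 \<in> borel_measurable M"
    using s st h by (auto intro!: random_variable)
  have "AE x in distr M borel (\<lambda>\<omega>. S h \<omega> - S 0 \<omega>). 0 \<le> x"
  proof (subst AE_distr_iff)
    show "AE \<omega> in M. 0 \<le> S h \<omega> - S 0 \<omega>"
      using start AE_space by eventually_elim (use nonneg[of h] h in auto)
  qed auto
  then have "AE x in distr M borel (\<lambda>\<omega>. S t \<omega> - S s \<omega>). 0 \<le> x"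
    unfolding h(2) stationary_increments[OF s h(1)] .
  then have "AE \<omega> in M. 0 \<le> S t \<omega> - S s \<omega>"
    by (subst (asm) AE_distr_iff) auto
  then show ?thesis by simp
qed

lemma antimono_cdf: "antimono_on {0..} (\<lambda>t. prob {\<omega> \<in> space M. S t \<omega> \<le> a})"
proof (rule monotone_onI)
  fix s t :: real
  assume "s \<in> {0..}" "t \<in> {0..}" and st: "s \<le> t"
  then have [measurable]: "S s \<in> borel_measurable M" "S t \<in> borel_measurable M" and s: "s \<ge> 0"
    by (auto intro!: random_variable)
  show "prob {\<omega> \<in> space M. S t \<omega> \<le> a} \<le> prob {\<omega> \<in> space M. S s \<omega> \<le> a}"
  proof (rule finite_measure_mono_AE)
    show "AE \<omega> in M. \<omega> \<in> {\<omega> \<in> space M. S t \<omega> \<le> a} \<longrightarrow> \<omega> \<in> {\<omega> \<in> space M. S s \<omega> \<le> a}"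
      using AE_increasing[OF s st] by eventually_elim auto
  qed measurable
qed

text \<open>
  A probability kernel need only be measurable on a generator that is closed under intersection,
  and on half-lines \<open>antimono_cdf\<close> makes it monotone in time.
\<close>

lemma measurable_law:
  "(\<lambda>t. distr M borel (S t)) \<in> measurable (restrict_space lborel {0..}) (prob_algebra borel)"
proof (rule measurable_prob_algebra_generated)
  show "sets (borel :: real measure) = sigma_sets UNIV (range (\<lambda>a. {..a}))"
    unfolding borel_eq_atMost by (intro sets_measure_of) auto
  show "Int_stable (range (\<lambda>a. {..a::real}))"
    by (auto simp: Int_stable_def)
  fix t :: real
  assume "t \<in> space (restrict_space lborel {0..})"
  then show "prob_space (distr M borel (S t))"
    by (intro prob_space_distr random_variable) (auto simp: space_restrict_space)
next
  fix A :: "real set"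
  assume "A \<in> range (\<lambda>a. {..a})"
  then obtain a where A: "A = {..a}" by auto
  let ?p = "\<lambda>t. prob {\<omega> \<in> space M. S t \<omega> \<le> a}"
  have "mono_on {0..} (\<lambda>t. - ?p t)"
    using antimono_cdf[of a] by (auto simp: monotone_on_def)
  then have "(\<lambda>t. - (- ?p t)) \<in> borel_measurable (restrict_space borel {0..})"
    by (intro borel_measurable_uminus borel_measurable_mono_on_fnc)
  then have "?p \<in> borel_measurable (restrict_space lborel {0..})"
    by (simp cong: measurable_cong_sets sets_restrict_space_cong)
  then have "(\<lambda>t. ennreal (?p t)) \<in> borel_measurable (restrict_space lborel {0..})"
    by measurable
  also have "?this \<longleftrightarrow> (\<lambda>t. emeasure (distr M borel (S t)) A)
      \<in> borel_measurable (restrict_space lborel {0..})"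
  proof (rule measurable_cong)
    fix t :: real
    assume "t \<in> space (restrict_space lborel {0..})"
    then have "S t \<in> borel_measurable M"
      by (intro random_variable) (auto simp: space_restrict_space)
    then show "ennreal (?p t) = emeasure (distr M borel (S t)) A"
      by (simp add: A emeasure_distr emeasure_eq_measure vimage_def Int_def conj_commute)
  qed
  finally show "(\<lambda>t. emeasure (distr M borel (S t)) A)
      \<in> borel_measurable (restrict_space lborel {0..})" .
qed auto

lemma nn_integral_potential:
  assumes sets: "sets U = sets borel"
    and U: "\<And>A. A \<in> sets borel \<Longrightarrow> emeasure U A = potential_measure M S A"
    and f [measurable]: "f \<in> borel_measurable borel"
  shows "(\<integral>\<^sup>+x. f x \<partial>U) = (\<integral>\<^sup>+t\<in>{0..}. (\<integral>\<^sup>+\<omega>. f (S t \<omega>) \<partial>M) \<partial>lborel)"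
proof -
  let ?T = "restrict_space lborel {0::real..}"
  let ?K = "\<lambda>t. distr M borel (S t)"
  have K: "?K \<in> measurable ?T (subprob_algebra borel)"
    by (rule measurable_prob_algebraD[OF measurable_law])
  have "(\<integral>\<^sup>+x. f x \<partial>U) = (\<integral>\<^sup>+t. (\<integral>\<^sup>+x. f x \<partial>?K t) \<partial>?T)"
  proof (rule nn_integral_mixture[OF K sets _ f])
    fix A :: "real set"
    assume A: "A \<in> sets borel"
    have "emeasure (?K t) A = emeasure M {\<omega> \<in> space M. S t \<omega> \<in> A}" if "t \<ge> 0" for t
      using A random_variable[OF that]
      by (simp add: emeasure_distr vimage_def Int_def conj_commute)
    then show "emeasure U A = (\<integral>\<^sup>+t. emeasure (?K t) A \<partial>?T)"
      unfolding U[OF A] potential_measure_def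
      by (subst nn_integral_restrict_space)
         (auto intro!: nn_integral_cong split: split_indicator)
  qed
  also have "\<dots> = (\<integral>\<^sup>+t\<in>{0..}. (\<integral>\<^sup>+\<omega>. f (S t \<omega>) \<partial>M) \<partial>lborel)"
    using random_variable
    by (subst nn_integral_restrict_space)
       (auto intro!: nn_integral_cong nn_integral_distr split: split_indicator)
  finally show ?thesis .
qed

lemma nn_integral_exp:
  assumes \<phi>: "laplace_exponent M S \<phi>" and t: "t \<ge> 0" and l: "l > 0"
  shows "(\<integral>\<^sup>+\<omega>. ennreal (exp (- l * S t \<omega>)) \<partial>M) = ennreal (exp (- t * \<phi> l))"
proof -
  have [measurable]: "S t \<in> borel_measurable M"
    using t by (rule random_variable)
  have "integrable M (\<lambda>\<omega>. exp (- l * S t \<omega>))"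
    using nonneg[OF t] l by (intro integrable_const_bound[where B = 1] AE_I2) auto
  then show ?thesis
    using \<phi> t l by (subst nn_integral_eq_integral) (auto simp: laplace_exponent_def)
qed

text \<open>
  If \<open>\<phi>\<close> vanished somewhere, then \<open>S\<close> would be identically zero and the potential measure would
  have an infinite atom at 0.
\<close>

lemma laplace_exponent_pos:
  assumes \<phi>: "laplace_exponent M S \<phi>" and no_atom: "potential_measure M S {0} = 0" and l: "l > 0"
  shows "\<phi> l > 0"
proof (rule ccontr)
  assume "\<not> \<phi> l > 0"
  have zero: "AE \<omega> in M. S t \<omega> = 0" if t: "t \<ge> 0" for t
  proof -
    have [measurable]: "S t \<in> borel_measurable M"
      using t by (rule random_variable)
    have int: "integrable M (\<lambda>\<omega>. exp (- l * S t \<omega>))"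
      using nonneg[OF t] l by (intro integrable_const_bound[where B = 1] AE_I2) auto
    have "1 \<le> exp (- t * \<phi> l)"
      using \<open>\<not> \<phi> l > 0\<close> t by (simp add: mult_nonneg_nonpos)
    also have "\<dots> = (LINT \<omega>|M. exp (- l * S t \<omega>))"
      using \<phi> t l by (simp add: laplace_exponent_def)
    finally have ge: "(LINT \<omega>|M. 1 - exp (- l * S t \<omega>)) \<le> 0"
      using int by (simp add: prob_space)
    have nn: "AE \<omega> in M. 0 \<le> 1 - exp (- l * S t \<omega>)"
      using nonneg[OF t] l by (intro AE_I2) auto
    have "(LINT \<omega>|M. 1 - exp (- l * S t \<omega>)) = 0"
      using ge integral_nonneg_AE[OF nn] by simp
    then have "AE \<omega> in M. 1 - exp (- l * S t \<omega>) = 0"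
      using int nn by (subst (asm) integral_nonneg_eq_0_iff_AE) auto
    then show ?thesis
      by eventually_elim (use l in auto)
  qed
  have one: "emeasure M {\<omega> \<in> space M. S t \<omega> \<in> {0}} = 1" if t: "t \<ge> 0" for t
  proof -
    have [measurable]: "S t \<in> borel_measurable M"
      using t by (rule random_variable)
    show ?thesis
      by (rule emeasure_eq_1_AE) (use zero[OF t] in auto)
  qed
  have "potential_measure M S {0} = (\<integral>\<^sup>+t. indicator {0::real..} t \<partial>lborel)"
    unfolding potential_measure_def using one by (intro nn_integral_cong) (auto split: split_indicator)
  moreover have "emeasure lborel {0..1::real} \<le> emeasure lborel {0::real..}"
    by (intro emeasure_mono) auto
  ultimately show False using no_atom by simp
qed

lemma laplace_potential:
  assumes \<phi>: "laplace_exponent M S \<phi>" and pos: "\<phi> l > 0" and l: "l > 0"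
    and sets: "sets U = sets borel"
    and U: "\<And>A. A \<in> sets borel \<Longrightarrow> emeasure U A = potential_measure M S A"
  shows "(\<integral>\<^sup>+x. ennreal (exp (- l * x)) \<partial>U) = ennreal (1 / \<phi> l)"
proof -
  have "(\<integral>\<^sup>+x. ennreal (exp (- l * x)) \<partial>U)
      = (\<integral>\<^sup>+t\<in>{0..}. (\<integral>\<^sup>+\<omega>. ennreal (exp (- l * S t \<omega>)) \<partial>M) \<partial>lborel)"
    by (rule nn_integral_potential[OF sets U]) auto
  \<comment> \<open>Up to the factor \<open>1 / \<phi> l\<close> the integrand is the exponential density with rate \<open>\<phi> l\<close>.\<close>
  also have "\<dots> = (\<integral>\<^sup>+t. ennreal (1 / \<phi> l) * ennreal (erlang_density 0 (\<phi> l) t * t ^ 0) \<partial>lborel)"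
    using pos nn_integral_exp[OF \<phi> _ l]
    by (intro nn_integral_cong)
       (auto simp: erlang_density_def ac_simps simp flip: ennreal_mult' split: split_indicator)
  also have "\<dots> = ennreal (1 / \<phi> l)"
    using nn_integral_erlang_ith_moment[OF pos, of 0 0] by (subst nn_integral_cmult) auto
  finally show ?thesis .
qed

text \<open>
  On the set \<open>{0}\<close> the density formula says that the potential measure has no atom at 0, which is
  what makes \<open>\<phi>\<close> positive; elsewhere it identifies the measure whose transform is \<open>1 / \<phi>\<close>.
\<close>

lemma decreasing_density_potential:
  assumes \<phi>: "laplace_exponent M S \<phi>" and u: "decreasing_potential_density M S u"
  defines "v \<equiv> (\<lambda>x. indicator {0<..} x * u x)"
  shows "decreasing_density v" and "\<And>l. l > 0 \<Longrightarrow> decreasing_density.laplace v l = 1 / \<phi> l"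
    and "\<And>l. l > 0 \<Longrightarrow> \<phi> l > 0"
proof -
  have u_pos: "u t > 0" if "t > 0" for t
    using u that by (simp add: decreasing_potential_density_def)
  have anti: "antimono_on {0<..} u"
    using u by (simp add: decreasing_potential_density_def)
  have "mono_on {0<..} (\<lambda>t. - u t)"
    using anti by (auto simp: monotone_on_def)
  then have "(\<lambda>t. - (- u t)) \<in> borel_measurable (restrict_space borel {0<..})"
    by (intro borel_measurable_uminus borel_measurable_mono_on_fnc)
  then have v_meas [measurable]: "v \<in> borel_measurable borel"
    by (simp add: v_def borel_measurable_restrict_space_iff)
  have v_nonneg: "v x \<ge> 0" for x
    using u_pos[of x] by (auto simp: v_def split: split_indicator)
  define U where "U = density lborel (\<lambda>x. ennreal (v x))"
  have sets: "sets U = sets borel" by (simp add: U_def)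
  have U: "emeasure U A = potential_measure M S A" if A: "A \<in> sets borel" for A
  proof -
    have "emeasure U A = (\<integral>\<^sup>+t\<in>A. ennreal (v t) \<partial>lborel)"
      using A by (simp add: U_def emeasure_density)
    also have "\<dots> = (\<integral>\<^sup>+t\<in>A \<inter> {0<..}. ennreal (u t) \<partial>lborel)"
      by (intro nn_integral_cong) (auto simp: v_def split: split_indicator)
    finally show ?thesis
      using u A by (simp add: decreasing_potential_density_def)
  qed
  have "potential_measure M S {0} = 0"
    using u by (auto simp: decreasing_potential_density_def)
  then show \<phi>_pos: "\<phi> l > 0" if "l > 0" for l
    using laplace_exponent_pos[OF \<phi>] that by blast
  have bochner: "has_bochner_integral lborel (\<lambda>x. v x * exp (- l * x)) (1 / \<phi> l)" if l: "l > 0" for l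
  proof (rule has_bochner_integral_nn_integral)
    have "(\<integral>\<^sup>+x. ennreal (v x * exp (- l * x)) \<partial>lborel) = (\<integral>\<^sup>+x. ennreal (exp (- l * x)) \<partial>U)"
      unfolding U_def using v_nonneg by (subst nn_integral_density) (auto simp: ennreal_mult')
    then show "(\<integral>\<^sup>+x. ennreal (v x * exp (- l * x)) \<partial>lborel) = ennreal (1 / \<phi> l)"
      using laplace_potential[OF \<phi> \<phi>_pos[OF l] l sets U] by simp
  qed (use v_nonneg \<phi>_pos[OF l] in auto)
  show dec: "decreasing_density v"
  proof
    show "v \<in> borel_measurable borel" by (rule v_meas)
    show "antimono_on {0<..} v"
      using anti by (auto simp: monotone_on_def v_def)
    show "integrable lborel (\<lambda>x. v x * exp (- l * x))" if "l > 0" for l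
      using bochner[OF that] by (simp add: has_bochner_integral_iff)
  qed (use u_pos in \<open>auto simp: v_def\<close>)
  show "decreasing_density.laplace v l = 1 / \<phi> l" if "l > 0" for l
    using bochner[OF that] by (simp add: decreasing_density.laplace_def[OF dec] has_bochner_integral_iff)
qed

end

section \<open>The behaviour of the potential density at zero\<close>

theorem proposition2p4:
  fixes M :: "'a measure" and S :: "real \<Rightarrow> 'a \<Rightarrow> real" and \<phi> u :: "real \<Rightarrow> real"
  assumes "subordinator M S"
    and "laplace_exponent M S \<phi>"
    and "decreasing_potential_density M S u"
    and "deriv_scaling_condition \<phi>"
  shows "comparable_at_zero u (\<lambda>t. t powr (- 2) * (deriv \<phi> (1 / t) / (\<phi> (1 / t))\<^sup>2))"
proof -
  interpret subordinator M S by fact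
  define v where "v = (\<lambda>x. indicator {0<..} x * u x)"
  note potential = decreasing_density_potential[OF assms(2,3), folded v_def]
  interpret decreasing_density v by (rule potential(1))
  have \<phi>_pos: "\<phi> l > 0" if "l > 0" for l using potential(3)[OF that] .
  have deriv: "deriv \<phi> l = moment l * (\<phi> l)\<^sup>2" if "l > 0" for l
    using potential(2) that by (rule deriv_reciprocal_laplace)
  obtain \<sigma> l\<^sub>0 \<delta> where params: "\<sigma> > 0" "l\<^sub>0 > 0" "\<delta> > 0"
    and scaling: "\<And>x l. x \<ge> 1 \<Longrightarrow> l \<ge> l\<^sub>0 \<Longrightarrow> deriv \<phi> (l * x) / deriv \<phi> l \<le> \<sigma> * x powr (- \<delta>)"
    using assms(4) unfolding deriv_scaling_condition_def by metis
  have "comparable_at_zero v (\<lambda>t. moment (1 / t) / t\<^sup>2)"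
  proof (rule comparable_density_moment[OF params])
    fix x l :: real
    assume x: "x \<ge> 1" and l: "l \<ge> l\<^sub>0"
    have l_pos: "l > 0" "l * x > 0" using x l params by auto
    have "1 / \<phi> (l * x) \<le> 1 / \<phi> l"
      using laplace_antimono[of l "l * x"] x l_pos by (simp add: potential(2))
    then have \<phi>_mono: "(\<phi> l)\<^sup>2 \<le> (\<phi> (l * x))\<^sup>2"
      using \<phi>_pos l_pos by (intro power_mono) (auto simp: field_simps intro: less_imp_le)
    have "moment (l * x) * (\<phi> l)\<^sup>2 \<le> moment (l * x) * (\<phi> (l * x))\<^sup>2"
      using \<phi>_mono moment_pos[OF l_pos(2)] by (intro mult_left_mono) auto
    also have "\<dots> \<le> \<sigma> * x powr (- \<delta>) * (moment l * (\<phi> l)\<^sup>2)"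
      using scaling[OF x l] moment_pos[OF l_pos(1)] \<phi>_pos[OF l_pos(1)]
      by (simp add: deriv l_pos pos_divide_le_eq)
    finally show "moment (l * x) \<le> \<sigma> * x powr (- \<delta>) * moment l"
      using \<phi>_pos[OF l_pos(1)] by (simp flip: mult.assoc)
  qed
  then obtain c\<^sub>1 c\<^sub>2 where c: "c\<^sub>1 > 0" "c\<^sub>2 > 0"
    and ev: "\<forall>\<^sub>F t in at_right 0. c\<^sub>1 \<le> v t / (moment (1 / t) / t\<^sup>2)
      \<and> v t / (moment (1 / t) / t\<^sup>2) \<le> c\<^sub>2"
    unfolding comparable_at_zero_def by blast
  have eq: "v t / (moment (1 / t) / t\<^sup>2)
      = u t / (t powr (- 2) * (deriv \<phi> (1 / t) / (\<phi> (1 / t))\<^sup>2))" if t: "t > 0" for t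
    using t \<phi>_pos[of "1 / t"] by (simp add: deriv v_def powr_minus divide_inverse)
  have "\<forall>\<^sub>F t in at_right 0. c\<^sub>1 \<le> u t / (t powr (- 2) * (deriv \<phi> (1 / t) / (\<phi> (1 / t))\<^sup>2))
      \<and> u t / (t powr (- 2) * (deriv \<phi> (1 / t) / (\<phi> (1 / t))\<^sup>2)) \<le> c\<^sub>2"
    using ev eventually_at_right_less[of "0::real"] by eventually_elim (simp only: eq)
  with c show ?thesis
    unfolding comparable_at_zero_def by blast
qed

end
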